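(* Let $X_4=\{x_1,x_2,x_3,x_4\}$, let $G$ be the quantum automorphism group of $X_4$, so $C(G)=A_{aut}(X_4)$, and let $H$ be the quantum subgroup of $G$ that fixes $x_1$, so $C(H)=A_{aut}(X_3)=C(S_3)$, with corresponding surjection $\theta:C(G)\to C(H)$. Then the $G$-algebras $C(H\backslash G)=\{a\in C(G):(\theta\otimes1)\Phi_G(a)=1\otimes a\}$ and $C(X_4)$ are not isomorphic to each other.
   Context: $A_{aut}(X_n)$, the quantum automorphism (quantum permutation) group of the space $X_n=\{x_1,\dots,x_n\}$ with $n$ points, is the universal unital $C^*$-algebra generated by $a_{ij}$ ($1\le i,j\le n$) with relations $a_{ij}^2=a_{ij}=a_{ij}^*$, $\sum_ja_{ij}=1$ for each $i$, $\sum_ia_{ij}=1$ for each $j$, with coproduct $\Phi(a_{ij})=\sum_ka_{ik}\otimes a_{kj}$. It acts on $C(X_n)$ by $e_j\mapsto\sum_ie_i\otimes a_{ij}$, where $e_i$ is the characteristic function of $\{x_i\}$. As a $C^*$-algebra $A_{aut}(X_3)=C(S_3)$, and the quantum subgroup of $G$ fixing $x_1$ is given by the surjection $\theta:A_{aut}(X_4)\to A_{aut}(X_3)=C(S_3)$ obtained by setting $a_{11}=1$ and $a_{1j}=a_{j1}=0$ for $j\ne1$, the remaining $a_{ij}$ ($2\le i,j\le4$) being sent to the generators of $A_{aut}(X_3)$. $\Phi_G$ is the coproduct of $C(G)$; $C(H\backslash G)$ carries the natural action $\Phi_G|_{C(H\backslash G)}:C(H\backslash G)\to C(H\backslash G)\otimes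 C(G)$ of $G$. A $G$-algebra is a $C^*$-algebra with an action of $G$ (a coassociative unital $*$-homomorphism $\alpha:B\to B\otimes C(G)$ compatible with the counit and having a dense $*$-subalgebra $\mathcal B$ with $\alpha(\mathcal B)\subseteq\mathcal B\otimes\mathcal A$, $\mathcal A$ the canonical dense Hopf $*$-subalgebra of $C(G)$); an isomorphism of $G$-algebras is a $*$-isomorphism intertwining the actions. *)

theory Defs
  imports "HOL-Analysis.Analysis" "HOL-Algebra.Algebraic_Closure_Type"
begin

section \<open>Unital \<open>C\<^sup>*\<close>-algebras\<close>

text \<open>
  \<open>C\<^sup>*\<close>-algebras are carrier-based, extending the rings and modules of HOL-Algebra.
  The scalars are \<^term>\<open>ring_of_type_algebra :: complex ring\<close>, i.e. the field of complex
  numbers viewed as a record.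
\<close>

record 'a cstar = "(complex, 'a) module" +
  adj :: "'a \<Rightarrow> 'a"
  cnorm :: "'a \<Rightarrow> real"

definition star_algebra :: "'a cstar \<Rightarrow> bool" where
  "star_algebra A \<longleftrightarrow>
     ring A \<and> module (ring_of_type_algebra :: complex ring) A \<and>
     (\<forall>c. \<forall>x\<in>carrier A. \<forall>y\<in>carrier A.
        (c \<odot>\<^bsub>A\<^esub> x) \<otimes>\<^bsub>A\<^esub> y = c \<odot>\<^bsub>A\<^esub> (x \<otimes>\<^bsub>A\<^esub> y) \<and>
        x \<otimes>\<^bsub>A\<^esub> (c \<odot>\<^bsub>A\<^esub> y) = c \<odot>\<^bsub>A\<^esub> (x \<otimes>\<^bsub>A\<^esub> y)) \<and>
     (\<forall>x\<in>carrier A. adj A x \<in> carrier A \<and> adj A (adj A x) = x) \<and>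
     (\<forall>x\<in>carrier A. \<forall>y\<in>carrier A.
        adj A (x \<oplus>\<^bsub>A\<^esub> y) = adj A x \<oplus>\<^bsub>A\<^esub> adj A y \<and>
        adj A (x \<otimes>\<^bsub>A\<^esub> y) = adj A y \<otimes>\<^bsub>A\<^esub> adj A x) \<and>
     (\<forall>c. \<forall>x\<in>carrier A. adj A (c \<odot>\<^bsub>A\<^esub> x) = cnj c \<odot>\<^bsub>A\<^esub> adj A x)"

definition cstar_norm :: "'a cstar \<Rightarrow> ('a \<Rightarrow> real) \<Rightarrow> bool" where
  "cstar_norm A q \<longleftrightarrow>
     (\<forall>x\<in>carrier A. 0 \<le> q x \<and> (q x = 0 \<longleftrightarrow> x = \<zero>\<^bsub>A\<^esub>)) \<and>
     (\<forall>c. \<forall>x\<in>carrier A. q (c \<odot>\<^bsub>A\<^esub> x) = cmod c * q x) \<and>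
     (\<forall>x\<in>carrier A. \<forall>y\<in>carrier A.
        q (x \<oplus>\<^bsub>A\<^esub> y) \<le> q x + q y \<and> q (x \<otimes>\<^bsub>A\<^esub> y) \<le> q x * q y) \<and>
     (\<forall>x\<in>carrier A. q (adj A x \<otimes>\<^bsub>A\<^esub> x) = (q x)\<^sup>2)"

definition cdist :: "'a cstar \<Rightarrow> 'a \<Rightarrow> 'a \<Rightarrow> real" where
  "cdist A x y = cnorm A (x \<ominus>\<^bsub>A\<^esub> y)"

definition cnorm_complete :: "'a cstar \<Rightarrow> bool" where
  "cnorm_complete A \<longleftrightarrow>
     (\<forall>s :: nat \<Rightarrow> 'a. range s \<subseteq> carrier A \<and>
          (\<forall>e>0. \<exists>N. \<forall>m\<ge>N. \<forall>n\<ge>N. cdist A (s m) (s n) < e) \<longrightarrow>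
        (\<exists>l\<in>carrier A. (\<lambda>n. cdist A (s n) l) \<longlonglongrightarrow> 0))"

definition cstar_algebra :: "'a cstar \<Rightarrow> bool" where
  "cstar_algebra A \<longleftrightarrow> star_algebra A \<and> cstar_norm A (cnorm A) \<and> cnorm_complete A"

definition cstar_subalgebra :: "'a set \<Rightarrow> 'a cstar \<Rightarrow> bool" where
  "cstar_subalgebra S A \<longleftrightarrow> S \<subseteq> carrier A \<and> cstar_algebra (A\<lparr>carrier := S\<rparr>)"

definition norm_closure :: "'a cstar \<Rightarrow> 'a set \<Rightarrow> 'a set" where
  "norm_closure A S = {x \<in> carrier A. \<forall>e>0. \<exists>y\<in>S. cdist A x y < e}"

text \<open>\<^const>\<open>ring_hom\<close> preserves the unit, so these are the unital \<open>*\<close>-homomorphisms.\<close>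

definition star_hom :: "'a cstar \<Rightarrow> 'b cstar \<Rightarrow> ('a \<Rightarrow> 'b) set" where
  "star_hom A B = {f \<in> ring_hom A B.
     (\<forall>c. \<forall>x\<in>carrier A. f (c \<odot>\<^bsub>A\<^esub> x) = c \<odot>\<^bsub>B\<^esub> f x) \<and>
     (\<forall>x\<in>carrier A. f (adj A x) = adj B (f x))}"

definition star_iso :: "'a cstar \<Rightarrow> 'b cstar \<Rightarrow> ('a \<Rightarrow> 'b) set" where
  "star_iso A B = {f \<in> star_hom A B. bij_betw f (carrier A) (carrier B)}"


section \<open>Minimal tensor products\<close>

definition alg_tensor :: "'a cstar \<Rightarrow> 'b cstar \<Rightarrow> 't cstar \<Rightarrow> ('a \<Rightarrow> 'b \<Rightarrow> 't) \<Rightarrow> 't set" where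
  "alg_tensor A B T t =
     {finsum T (\<lambda>i. t (x i) (y i)) {..<n} | (n :: nat) x y.
        x \<in> {..<n} \<rightarrow> carrier A \<and> y \<in> {..<n} \<rightarrow> carrier B}"

definition lin_indep :: "'a cstar \<Rightarrow> nat set \<Rightarrow> (nat \<Rightarrow> 'a) \<Rightarrow> bool" where
  "lin_indep A I y \<longleftrightarrow>
     (\<forall>c :: nat \<Rightarrow> complex. finsum A (\<lambda>i. c i \<odot>\<^bsub>A\<^esub> y i) I = \<zero>\<^bsub>A\<^esub> \<longrightarrow> (\<forall>i\<in>I. c i = 0))"

text \<open>
  \<open>min_tensor A B T t\<close>: the \<open>C\<^sup>*\<close>-algebra \<open>T\<close>, with elementary tensors \<open>t x y\<close>, is the minimal
  (spatial) tensor product of \<open>A\<close> and \<open>B\<close>. The clause about linear independence says that the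
  linear map from the algebraic tensor product to \<open>T\<close> induced by \<open>t\<close> is injective; the last two
  clauses say that \<open>T\<close> is the completion of the algebraic tensor product in its least
  \<open>C\<^sup>*\<close>-norm. By Takesaki's theorem the spatial norm is this least norm, so \<open>T\<close> exists and is
  unique up to isomorphism.
\<close>

definition min_tensor :: "'a cstar \<Rightarrow> 'b cstar \<Rightarrow> 't cstar \<Rightarrow> ('a \<Rightarrow> 'b \<Rightarrow> 't) \<Rightarrow> bool" where
  "min_tensor A B T t \<longleftrightarrow>
     cstar_algebra A \<and> cstar_algebra B \<and> cstar_algebra T \<and>
     (\<forall>x\<in>carrier A. \<forall>y\<in>carrier B. t x y \<in> carrier T) \<and>
     (\<forall>x\<in>carrier A. \<forall>x'\<in>carrier A. \<forall>y\<in>carrier B. t (x \<oplus>\<^bsub>A\<^esub> x') y = t x y \<oplus>\<^bsub>T\<^esub> t x' y) \<and>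
     (\<forall>x\<in>carrier A. \<forall>y\<in>carrier B. \<forall>y'\<in>carrier B. t x (y \<oplus>\<^bsub>B\<^esub> y') = t x y \<oplus>\<^bsub>T\<^esub> t x y') \<and>
     (\<forall>c. \<forall>x\<in>carrier A. \<forall>y\<in>carrier B.
        t (c \<odot>\<^bsub>A\<^esub> x) y = c \<odot>\<^bsub>T\<^esub> t x y \<and> t x (c \<odot>\<^bsub>B\<^esub> y) = c \<odot>\<^bsub>T\<^esub> t x y) \<and>
     (\<forall>x\<in>carrier A. \<forall>x'\<in>carrier A. \<forall>y\<in>carrier B. \<forall>y'\<in>carrier B.
        t x y \<otimes>\<^bsub>T\<^esub> t x' y' = t (x \<otimes>\<^bsub>A\<^esub> x') (y \<otimes>\<^bsub>B\<^esub> y')) \<and>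
     t \<one>\<^bsub>A\<^esub> \<one>\<^bsub>B\<^esub> = \<one>\<^bsub>T\<^esub> \<and>
     (\<forall>x\<in>carrier A. \<forall>y\<in>carrier B. adj T (t x y) = t (adj A x) (adj B y)) \<and>
     (\<forall>I x y. finite I \<and> x \<in> I \<rightarrow> carrier A \<and> y \<in> I \<rightarrow> carrier B \<and> lin_indep B I y \<and>
        finsum T (\<lambda>i. t (x i) (y i)) I = \<zero>\<^bsub>T\<^esub> \<longrightarrow> (\<forall>i\<in>I. x i = \<zero>\<^bsub>A\<^esub>)) \<and>
     norm_closure T (alg_tensor A B T t) = carrier T \<and>
     (\<forall>q. cstar_norm (T\<lparr>carrier := alg_tensor A B T t\<rparr>) q \<longrightarrow>
        (\<forall>z\<in>alg_tensor A B T t. cnorm T z \<le> q z))"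

text \<open>\<open>tensor_hom A B T t T' t' f g F\<close>: \<open>F\<close> is \<open>f \<otimes> g\<close> on the tensor product \<open>T\<close> of \<open>A\<close>, \<open>B\<close>.\<close>

definition tensor_hom :: "'a cstar \<Rightarrow> 'b cstar \<Rightarrow> 't cstar \<Rightarrow> ('a \<Rightarrow> 'b \<Rightarrow> 't) \<Rightarrow>
    'u cstar \<Rightarrow> ('c \<Rightarrow> 'd \<Rightarrow> 'u) \<Rightarrow> ('a \<Rightarrow> 'c) \<Rightarrow> ('b \<Rightarrow> 'd) \<Rightarrow> ('t \<Rightarrow> 'u) \<Rightarrow> bool" where
  "tensor_hom A B T t T' t' f g F \<longleftrightarrow>
     F \<in> star_hom T T' \<and> (\<forall>x\<in>carrier A. \<forall>y\<in>carrier B. F (t x y) = t' (f x) (g y))"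


section \<open>Quantum automorphism groups of finite spaces\<close>

definition magic_unitary :: "nat \<Rightarrow> 'a cstar \<Rightarrow> (nat \<Rightarrow> nat \<Rightarrow> 'a) \<Rightarrow> bool" where
  "magic_unitary n A u \<longleftrightarrow>
     (\<forall>i\<in>{1..n}. \<forall>j\<in>{1..n}. u i j \<in> carrier A \<and>
        u i j \<otimes>\<^bsub>A\<^esub> u i j = u i j \<and> adj A (u i j) = u i j) \<and>
     (\<forall>i\<in>{1..n}. finsum A (\<lambda>j. u i j) {1..n} = \<one>\<^bsub>A\<^esub>) \<and>
     (\<forall>j\<in>{1..n}. finsum A (\<lambda>i. u i j) {1..n} = \<one>\<^bsub>A\<^esub>)"

text \<open>
  \<open>A_aut n A a\<close>: \<open>A\<close> is the universal unital \<open>C\<^sup>*\<close>-algebra generated by the entries of a magic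
  unitary \<open>a\<close>. HOL cannot quantify over all types, so the universal property ranges over the
  \<open>C\<^sup>*\<close>-algebras whose carrier is a set of elements of \<^typ>\<open>nat \<Rightarrow> complex\<close>. This loses
  nothing: the entries of a magic unitary generate a separable \<open>C\<^sup>*\<close>-algebra, which has at most
  continuum many elements and hence has an isomorphic copy of this kind. The homomorphism \<open>f\<close> is
  unique on \<open>carrier A\<close> because \<open>A\<close> is generated by the entries of \<open>a\<close>.
\<close>

definition A_aut :: "nat \<Rightarrow> 'a cstar \<Rightarrow> (nat \<Rightarrow> nat \<Rightarrow> 'a) \<Rightarrow> bool" where
  "A_aut n A a \<longleftrightarrow>
     cstar_algebra A \<and> magic_unitary n A a \<and>
     (\<forall>S. cstar_subalgebra S A \<and> (\<forall>i\<in>{1..n}. \<forall>j\<in>{1..n}. a i j \<in> S) \<longrightarrow> S = carrier A) \<and>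
     (\<forall>(B :: (nat \<Rightarrow> complex) cstar) b. cstar_algebra B \<and> magic_unitary n B b \<longrightarrow>
        (\<exists>f\<in>star_hom A B. \<forall>i\<in>{1..n}. \<forall>j\<in>{1..n}. f (a i j) = b i j))"

text \<open>\<open>T\<close>, \<open>t\<close> is \<open>C(G) \<otimes> C(G)\<close> and \<open>\<Phi>\<close> is the coproduct of \<open>C(G) = A\<close>.\<close>

definition quantum_aut_group :: "nat \<Rightarrow> 'a cstar \<Rightarrow> (nat \<Rightarrow> nat \<Rightarrow> 'a) \<Rightarrow>
    't cstar \<Rightarrow> ('a \<Rightarrow> 'a \<Rightarrow> 't) \<Rightarrow> ('a \<Rightarrow> 't) \<Rightarrow> bool" where
  "quantum_aut_group n A a T t \<Phi> \<longleftrightarrow>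
     A_aut n A a \<and> min_tensor A A T t \<and> \<Phi> \<in> star_hom A T \<and>
     (\<forall>i\<in>{1..n}. \<forall>j\<in>{1..n}. \<Phi> (a i j) = finsum T (\<lambda>k. t (a i k) (a k j)) {1..n})"

text \<open>The algebra \<open>C(X\<^sub>n)\<close>; the point \<open>x\<^sub>i\<close> is represented by the index \<open>i \<in> {1..n}\<close>.\<close>

definition C_X :: "nat \<Rightarrow> (nat \<Rightarrow> complex) cstar" where
  "C_X n = \<lparr>carrier = {1..n} \<rightarrow>\<^sub>E UNIV,
     monoid.mult = (\<lambda>f g. \<lambda>i\<in>{1..n}. f i * g i),
     one = (\<lambda>i\<in>{1..n}. 1),
     ring.zero = (\<lambda>i\<in>{1..n}. 0),
     add = (\<lambda>f g. \<lambda>i\<in>{1..n}. f i + g i),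
     smult = (\<lambda>c f. \<lambda>i\<in>{1..n}. c * f i),
     adj = (\<lambda>f. \<lambda>i\<in>{1..n}. cnj (f i)),
     cnorm = (\<lambda>f. SUP i\<in>{1..n}. cmod (f i))\<rparr>"

definition char_fun :: "nat \<Rightarrow> nat \<Rightarrow> nat \<Rightarrow> complex" where
  "char_fun n j = (\<lambda>i\<in>{1..n}. if i = j then 1 else 0)"


section \<open>Algebras with an action of a quantum group\<close>

text \<open>
  An algebra \<open>act_alg\<close> together with its tensor product \<open>act_tensor\<close>, \<open>act_elem\<close> with
  \<open>C(G)\<close> (of type \<open>'a cstar\<close>) and the action \<open>act_map\<close>.
\<close>

record ('a, 'b, 't) action =
  act_alg :: "'b cstar"
  act_tensor :: "'t cstar"
  act_elem :: "'b \<Rightarrow> 'a \<Rightarrow> 't"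
  act_map :: "'b \<Rightarrow> 't"

text \<open>Isomorphism of \<open>G\<close>-algebras, where \<open>A = C(G)\<close>: a \<open>*\<close>-isomorphism \<open>f\<close> with
  \<open>(f \<otimes> id) \<circ> \<alpha> = \<beta> \<circ> f\<close>. No other property of the actions enters, so the relation is defined on
  the bare data.\<close>

definition G_algebra_isomorphic ::
    "'a cstar \<Rightarrow> ('a, 'b, 's) action \<Rightarrow> ('a, 'c, 't) action \<Rightarrow> bool" where
  "G_algebra_isomorphic A \<alpha> \<beta> \<longleftrightarrow>
     (\<exists>f F. f \<in> star_iso (act_alg \<alpha>) (act_alg \<beta>) \<and>
        tensor_hom (act_alg \<alpha>) A (act_tensor \<alpha>) (act_elem \<alpha>) (act_tensor \<beta>) (act_elem \<beta>) f id F \<and>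
        (\<forall>x\<in>carrier (act_alg \<alpha>). F (act_map \<alpha> x) = act_map \<beta> (f x)))"

text \<open>
  \<open>C(H\G)\<close>, where \<open>T'\<close>, \<open>t'\<close> is \<open>C(H) \<otimes> C(G)\<close> and \<open>\<Theta> = \<theta> \<otimes> 1\<close>.
\<close>

definition coset_algebra :: "'a cstar \<Rightarrow> ('a \<Rightarrow> 's) \<Rightarrow> 'c cstar \<Rightarrow> ('c \<Rightarrow> 'a \<Rightarrow> 't) \<Rightarrow>
    ('s \<Rightarrow> 't) \<Rightarrow> 'a cstar" where
  "coset_algebra A \<Phi> C t' \<Theta> = A\<lparr>carrier := {x \<in> carrier A. \<Theta> (\<Phi> x) = t' \<one>\<^bsub>C\<^esub> x}\<rparr>"

text \<open>
  The restriction of the coproduct to a \<open>C\<^sup>*\<close>-subalgebra \<open>D\<close> of \<open>A = C(G)\<close>. The minimal tensor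
  product respects inclusions, so \<open>D \<otimes> C(G)\<close> is the closed span of the elementary tensors with
  first factor in \<open>D\<close> inside \<open>C(G) \<otimes> C(G)\<close>.
\<close>

definition restricted_action :: "'a cstar \<Rightarrow> 'a cstar \<Rightarrow> 's cstar \<Rightarrow> ('a \<Rightarrow> 'a \<Rightarrow> 's) \<Rightarrow> ('a \<Rightarrow> 's) \<Rightarrow>
    ('a, 'a, 's) action" where
  "restricted_action D A T t \<Phi> =
     \<lparr>act_alg = D, act_tensor = T\<lparr>carrier := norm_closure T (alg_tensor D A T t)\<rparr>,
      act_elem = t, act_map = \<Phi>\<rparr>"

end

(*
  The coset algebra is not commutative, whereas C(X_4) is, so there is not even an isomorphism
  of algebras. It contains a_11 and, since each row of theta(a_pu) with p >= 2 consists of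
  orthogonal projections and each column with u >= 2 sums to 1 over p >= 2, also
  x = sum_{p >= 2} a_p3 a_11 a_p4. To see that they do not commute, map A_aut(X_4) to the 2x2
  matrices by the block diagonal magic unitary with blocks (p, 1-p; 1-p, p) and (q, 1-q; 1-q, q)
  for two projections p, q: then a_11 goes to p, and x to q p (1-q) + (1-q) p q, the
  off-diagonal part of p with respect to q.
*)
theory Submission
  imports Defs
begin

section \<open>The \<open>C\<^sup>*\<close>-algebra of complex matrices\<close>

definition conj_transpose :: "complex^'n^'m \<Rightarrow> complex^'m^'n" where
  "conj_transpose M = (\<chi> i j. cnj (M $ j $ i))"

definition cscale :: "complex \<Rightarrow> complex^'n^'m \<Rightarrow> complex^'n^'m" where
  "cscale c M = (\<chi> i j. c * M $ i $ j)"

definition op_norm :: "complex^'n^'m \<Rightarrow> real" where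
  "op_norm M = onorm ((*v) M)"

section \<open>Operator norm: scaling, triangle inequality, submultiplicativity\<close>

lemma norm_cmult_vec:
  fixes v :: "complex^'n"
  shows "norm (\<chi> i. c * v $ i) = cmod c * norm v"
  by (simp add: norm_vec_def norm_mult L2_set_right_distrib)

lemma cscale_mult_vec:
  "cscale c M *v v = (\<chi> i. c * (M *v v) $ i)"
  by (simp add: cscale_def matrix_vector_mult_def vec_eq_iff sum_distrib_left mult.assoc)

lemma norm_mult_vec_le: "norm (M *v v) \<le> op_norm M * norm v"
  unfolding op_norm_def by (rule onorm) simp

lemma op_norm_le: "(\<And>v. norm (M *v v) \<le> b * norm v) \<Longrightarrow> op_norm M \<le> b"
  unfolding op_norm_def by (rule onorm_le)

lemma op_norm_nonneg: "0 \<le> op_norm M"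
  unfolding op_norm_def by (rule onorm_pos_le) simp

lemma op_norm_cscale: "op_norm (cscale c M) = cmod c * op_norm M"
proof -
  have le: "op_norm (cscale c M) \<le> cmod c * op_norm M" for c and M :: "complex^'a^'b"
    by (rule op_norm_le)
       (simp add: cscale_mult_vec norm_cmult_vec mult.assoc mult_left_mono norm_mult_vec_le)
  show ?thesis
  proof (cases "c = 0")
    case True
    then show ?thesis using le[of 0 M] op_norm_nonneg[of "cscale 0 M"] by simp
  next
    case False
    \<comment> \<open>The reverse inequality is \<open>le\<close> again, applied to the scalar
      \<open>inverse c\<close> and the matrix \<open>cscale c M\<close>.\<close>
    have "cscale (inverse c) (cscale c M) = M"
      using False by (simp add: cscale_def vec_eq_iff)
    with le[of "inverse c" "cscale c M"] have "op_norm M \<le> op_norm (cscale c M) / cmod c"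
      by (simp add: norm_inverse divide_inverse mult.commute)
    then have "cmod c * op_norm M \<le> op_norm (cscale c M)"
      using False by (simp add: field_simps)
    then show ?thesis using le[of c M] by simp
  qed
qed

lemma op_norm_add: "op_norm (M + N) \<le> op_norm M + op_norm N"
proof (rule op_norm_le)
  fix v
  have "norm ((M + N) *v v) \<le> norm (M *v v) + norm (N *v v)"
    by (simp add: matrix_vector_mult_add_rdistrib norm_triangle_ineq)
  then show "norm ((M + N) *v v) \<le> (op_norm M + op_norm N) * norm v"
    using norm_mult_vec_le[of M v] norm_mult_vec_le[of N v] by (simp add: distrib_right)
qed

lemma op_norm_mult: "op_norm (M ** N) \<le> op_norm M * op_norm N"
proof (rule op_norm_le)
  fix v
  have "norm ((M ** N) *v v) \<le> op_norm M * norm (N *v v)"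
    using norm_mult_vec_le[of M "N *v v"] by (simp add: matrix_vector_mul_assoc)
  also have "\<dots> \<le> op_norm M * (op_norm N * norm v)"
    by (rule mult_left_mono[OF norm_mult_vec_le op_norm_nonneg])
  finally show "norm ((M ** N) *v v) \<le> op_norm M * op_norm N * norm v"
    by (simp add: mult.assoc)
qed

text \<open>An entry is a coordinate of the image of a standard basis vector, which has norm
  1.\<close>

lemma cmod_entry_le_op_norm:
  fixes M :: "complex^'n^'m"
  shows "cmod (M $ i $ j) \<le> op_norm M"
proof -
  have "(M *v axis j 1) $ i = M $ i $ j"
    by (simp add: matrix_vector_mult_def axis_def if_distrib cong: if_cong)
  then have "cmod (M $ i $ j) \<le> norm (M *v axis j 1)"
    by (metis Finite_Cartesian_Product.norm_nth_le)
  also have "\<dots> \<le> op_norm M"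
    using norm_mult_vec_le[of M "axis j 1"] by (simp add: norm_axis_1)
  finally show ?thesis .
qed

text \<open>The \<open>norm\<close> of the vector type is the Frobenius norm, under which matrices
  are already known to be complete. This comparison and its converse below carry definiteness and
  completeness over to \<open>op_norm\<close>; the crude constant is harmless.\<close>

lemma norm_le_op_norm:
  fixes M :: "complex^'n^'m"
  shows "norm M \<le> real (CARD('m) * CARD('n)) * op_norm M"
proof -
  have "norm M \<le> (\<Sum>i\<in>UNIV. norm (M $ i))"
    unfolding norm_vec_def by (rule L2_set_le_sum) simp
  also have "\<dots> \<le> (\<Sum>i\<in>(UNIV::'m set). \<Sum>j\<in>(UNIV::'n set). cmod (M $ i $ j))"
    by (rule sum_mono) (unfold norm_vec_def, rule L2_set_le_sum, simp)
  also have "\<dots> \<le> (\<Sum>i\<in>(UNIV::'m set). \<Sum>j\<in>(UNIV::'n set). op_norm M)"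
    by (intro sum_mono cmod_entry_le_op_norm)
  finally show ?thesis by simp
qed

lemma op_norm_le_norm:
  fixes M :: "complex^'n^'m"
  shows "op_norm M \<le> real (CARD('m) * CARD('n)) * norm M"
proof (rule op_norm_le)
  fix v :: "complex^'n"
  have entry: "cmod (M $ i $ j * v $ j) \<le> norm M * norm v" for i j
    using Finite_Cartesian_Product.norm_nth_le[of M i]
      Finite_Cartesian_Product.norm_nth_le[of "M $ i" j]
      Finite_Cartesian_Product.norm_nth_le[of v j]
    by (simp add: norm_mult) (intro mult_mono; linarith?; simp)
  have "norm (M *v v) \<le> (\<Sum>i\<in>UNIV. norm ((M *v v) $ i))"
    unfolding norm_vec_def by (rule L2_set_le_sum) simp
  also have "\<dots> \<le> (\<Sum>i\<in>(UNIV::'m set). \<Sum>j\<in>(UNIV::'n set). norm M * norm v)"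
    unfolding matrix_vector_mult_def
    by (intro sum_mono) (simp only: vec_lambda_beta, intro sum_norm_le entry)
  finally show "norm (M *v v) \<le> real (CARD('m) * CARD('n)) * norm M * norm v"
    by (simp add: mult.assoc)
qed

lemma op_norm_eq_0: "op_norm M = 0 \<longleftrightarrow> M = 0"
proof
  assume "op_norm M = 0"
  then show "M = 0" using norm_le_op_norm[of M] by simp
next
  assume "M = 0"
  then show "op_norm M = 0"
    using op_norm_le_norm[of M] op_norm_nonneg[of M] by simp
qed

text \<open>The inner product here is the real part of the Hermitian one. The adjoint identity for
  the real part is enough, because it induces the same norm.\<close>

lemma inner_mult_vec: "(M *v v) \<bullet> w = v \<bullet> (conj_transpose M *v w)"
proof -
  have inner: "x \<bullet> y = Re (\<Sum>i\<in>UNIV. x $ i * cnj (y $ i))" for x y :: "complex^'k"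
    by (simp add: inner_vec_def inner_complex_def)
  have "(\<Sum>i\<in>UNIV. \<Sum>j\<in>UNIV. M $ i $ j * v $ j * cnj (w $ i)) =
      (\<Sum>j\<in>UNIV. \<Sum>i\<in>UNIV. M $ i $ j * v $ j * cnj (w $ i))"
    by (rule sum.swap)
  then show ?thesis
    by (simp add: inner matrix_vector_mult_def conj_transpose_def sum_distrib_left
        sum_distrib_right mult_ac)
qed

text \<open>Cauchy-Schwarz applied to the inner product of \<open>v\<close> with
  \<open>(conj_transpose M ** M) *v v\<close>, which equals the square of the norm of
  \<open>M *v v\<close>.\<close>

lemma op_norm_power2_le: "(op_norm M)\<^sup>2 \<le> op_norm (conj_transpose M ** M)"
proof -
  let ?b = "op_norm (conj_transpose M ** M)"
  have "norm (M *v v) \<le> sqrt ?b * norm v" for v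
  proof -
    have "(norm (M *v v))\<^sup>2 = v \<bullet> ((conj_transpose M ** M) *v v)"
      by (simp add: power2_norm_eq_inner inner_mult_vec matrix_vector_mul_assoc)
    also have "\<dots> \<le> norm v * (?b * norm v)"
      by (meson mult_left_mono norm_cauchy_schwarz norm_ge_zero norm_mult_vec_le order_trans)
    finally have "norm (M *v v) \<le> sqrt (?b * (norm v)\<^sup>2)"
      by (intro real_le_rsqrt) (simp add: power2_eq_square mult_ac)
    then show ?thesis by (simp add: real_sqrt_mult)
  qed
  then have "op_norm M \<le> sqrt ?b" by (rule op_norm_le)
  then have "(op_norm M)\<^sup>2 \<le> (sqrt ?b)\<^sup>2" by (intro power_mono op_norm_nonneg)
  then show ?thesis by (simp add: op_norm_nonneg)
qed

text \<open>Cancel one factor \<open>op_norm M\<close> between the previous bound and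
  submultiplicativity.\<close>

lemma op_norm_le_conj_transpose: "op_norm M \<le> op_norm (conj_transpose M)"
proof (cases "op_norm M = 0")
  case False
  have "op_norm M * op_norm M \<le> op_norm (conj_transpose M) * op_norm M"
    using op_norm_power2_le[of M] op_norm_mult[of "conj_transpose M" M]
    by (simp add: power2_eq_square)
  then show ?thesis using False op_norm_nonneg[of M] by simp
qed (simp add: op_norm_nonneg)

text \<open>The C*-identity. One half is the bound above; the other follows from submultiplicativity
  once the adjoint is seen not to increase the norm.\<close>

lemma op_norm_conj_transpose_mult:
  "op_norm (conj_transpose M ** M) = (op_norm M)\<^sup>2"
proof -
  have "conj_transpose (conj_transpose M) = M"
    by (simp add: conj_transpose_def vec_eq_iff)
  then have "op_norm (conj_transpose M) \<le> op_norm M"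
    using op_norm_le_conj_transpose[of "conj_transpose M"] by simp
  then have "op_norm (conj_transpose M ** M) \<le> op_norm M * op_norm M"
    using op_norm_mult[of "conj_transpose M" M] op_norm_nonneg[of M]
    by (meson mult_right_mono order_trans)
  then show ?thesis using op_norm_power2_le[of M] by (simp add: power2_eq_square)
qed

text \<open>The universal property in \<^const>\<open>A_aut\<close> only sees algebras of elements of type
  \<^typ>\<open>nat \<Rightarrow> complex\<close>, so the matrix algebra is transported along an injection \<open>e\<close>.\<close>

definition matrix_cstar :: "(complex^'n^'n \<Rightarrow> 'b) \<Rightarrow> 'b cstar" where
  "matrix_cstar e = \<lparr>carrier = range e,
     monoid.mult = (\<lambda>x y. e (inv_into UNIV e x ** inv_into UNIV e y)),
     one = e (mat 1),
     ring.zero = e 0,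
     add = (\<lambda>x y. e (inv_into UNIV e x + inv_into UNIV e y)),
     smult = (\<lambda>c x. e (cscale c (inv_into UNIV e x))),
     adj = (\<lambda>x. e (conj_transpose (inv_into UNIV e x))),
     cnorm = (\<lambda>x. op_norm (inv_into UNIV e x))\<rparr>"

section \<open>The transported matrices form a C*-algebra\<close>

lemma matrix_cstar_simps:
  assumes "inj e"
  shows "carrier (matrix_cstar e) = range e"
    and "e M \<otimes>\<^bsub>matrix_cstar e\<^esub> e N = e (M ** N)"
    and "\<one>\<^bsub>matrix_cstar e\<^esub> = e (mat 1)"
    and "\<zero>\<^bsub>matrix_cstar e\<^esub> = e 0"
    and "e M \<oplus>\<^bsub>matrix_cstar e\<^esub> e N = e (M + N)"
    and "c \<odot>\<^bsub>matrix_cstar e\<^esub> e M = e (cscale c M)"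
    and "adj (matrix_cstar e) (e M) = e (conj_transpose M)"
    and "cnorm (matrix_cstar e) (e M) = op_norm M"
  using assms by (simp_all add: matrix_cstar_def)

lemma star_algebra_matrix_cstar:
  assumes e: "inj e"
  shows "star_algebra (matrix_cstar e)"
proof -
  note s = matrix_cstar_simps[OF e]
  have ab: "abelian_group (matrix_cstar e)"
  proof (rule abelian_groupI)
    fix x assume "x \<in> carrier (matrix_cstar e)"
    then obtain M where "x = e M" by (auto simp: s)
    then show "\<exists>y\<in>carrier (matrix_cstar e). y \<oplus>\<^bsub>matrix_cstar e\<^esub> x = \<zero>\<^bsub>matrix_cstar e\<^esub>"
      by (intro bexI[of _ "e (- M)"]) (simp_all add: s)
  qed (auto simp: s add_ac)
  have mon: "monoid (matrix_cstar e)"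
    by (rule monoidI) (auto simp: s matrix_mul_assoc)
  have ring: "ring (matrix_cstar e)"
    by (rule ringI[OF ab mon]) (auto simp: s matrix_matrix_mult_def vec_eq_iff algebra_simps sum.distrib
      intro!: arg_cong[where f = e])
  have mod: "module (ring_of_type_algebra :: complex ring) (matrix_cstar e)"
    by (rule moduleI[OF cring_from_type_algebra ab])
       (auto simp: s ring_of_type_algebra_def cscale_def vec_eq_iff algebra_simps
         intro!: arg_cong[where f = e])
  show ?thesis
    unfolding star_algebra_def
    by (intro conjI ring mod)
       (auto simp: s conj_transpose_def cscale_def matrix_matrix_mult_def vec_eq_iff
         sum_distrib_left mult_ac intro!: arg_cong[where f = e])
qed

lemma cdist_matrix_cstar:
  assumes e: "inj e"
  shows "cdist (matrix_cstar e) (e M) (e N) = op_norm (M - N)"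
proof -
  interpret ring "matrix_cstar e"
    using star_algebra_matrix_cstar[OF e] by (simp add: star_algebra_def)
  note s = matrix_cstar_simps[OF e]
  have "\<ominus>\<^bsub>matrix_cstar e\<^esub> e N = e (- N)"
    by (rule minus_equality) (simp_all add: s)
  then show ?thesis
    by (simp add: cdist_def a_minus_def s)
qed

lemma cstar_algebra_matrix_cstar:
  fixes e :: "complex^'n^'n \<Rightarrow> 'b"
  assumes e: "inj e"
  shows "cstar_algebra (matrix_cstar e)"
proof -
  note s = matrix_cstar_simps[OF e]
  have norm: "cstar_norm (matrix_cstar e) (cnorm (matrix_cstar e))"
    unfolding cstar_norm_def
    by (auto simp: s op_norm_nonneg op_norm_eq_0 inj_eq[OF e] op_norm_cscale op_norm_add
        op_norm_mult op_norm_conj_transpose_mult)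
  have complete: "cnorm_complete (matrix_cstar e)"
    unfolding cnorm_complete_def
  proof (intro allI impI; elim conjE)
    fix s :: "nat \<Rightarrow> 'b"
    \<comment> \<open>\<open>?K\<close> is the constant in both norm comparisons: it turns a Cauchy
      sequence for \<open>op_norm\<close> into one for the Frobenius norm, and turns the Frobenius
      limit back into a limit for \<open>op_norm\<close>.\<close>
    let ?K = "real (CARD('n) * CARD('n))"
    assume range: "range s \<subseteq> carrier (matrix_cstar e)"
      and cauchy: "\<forall>\<epsilon>>0. \<exists>N. \<forall>m\<ge>N. \<forall>n\<ge>N. cdist (matrix_cstar e) (s m) (s n) < \<epsilon>"
    have "\<forall>n. \<exists>M. s n = e M"
      using range by (auto simp: matrix_cstar_simps(1)[OF e])
    then obtain S where S: "s n = e (S n)" for n by metis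
    have "Cauchy S"
      unfolding Cauchy_def
    proof (intro allI impI)
      fix \<epsilon> :: real assume "0 < \<epsilon>"
      then obtain N where N: "op_norm (S m - S n) < \<epsilon> / ?K" if "m \<ge> N" "n \<ge> N" for m n
        using cauchy[rule_format, of "\<epsilon> / ?K"] by (auto simp: S cdist_matrix_cstar[OF e])
      have "dist (S m) (S n) < \<epsilon>" if "m \<ge> N" "n \<ge> N" for m n
        using norm_le_op_norm[of "S m - S n"] N[OF that]
        by (simp add: dist_norm field_simps)
      then show "\<exists>N. \<forall>m\<ge>N. \<forall>n\<ge>N. dist (S m) (S n) < \<epsilon>" by blast
    qed
    then obtain L where L: "S \<longlonglongrightarrow> L"
      by (meson Cauchy_convergent convergentD)
    then have "(\<lambda>n. ?K * norm (S n - L)) \<longlonglongrightarrow> 0"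
      by (intro tendsto_mult_right_zero tendsto_norm_zero) (simp add: LIM_zero)
    then have "(\<lambda>n. op_norm (S n - L)) \<longlonglongrightarrow> 0"
      by (rule tendsto_sandwich[OF _ _ tendsto_const, rotated 2])
         (intro always_eventually allI op_norm_nonneg op_norm_le_norm)+
    then show "\<exists>l\<in>carrier (matrix_cstar e). (\<lambda>n. cdist (matrix_cstar e) (s n) l) \<longlonglongrightarrow> 0"
      by (intro bexI[of _ "e L"])
         (simp_all add: S cdist_matrix_cstar[OF e] matrix_cstar_simps(1)[OF e])
  qed
  show ?thesis
    using star_algebra_matrix_cstar[OF e] norm complete by (simp add: cstar_algebra_def)
qed

section \<open>Finite sums and orthogonal idempotents\<close>

lemma (in abelian_monoid) finsum_swap:
  assumes "finite I" "finite J" "\<And>i j. i \<in> I \<Longrightarrow> j \<in> J \<Longrightarrow> g i j \<in> carrier G"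
  shows "finsum G (\<lambda>i. finsum G (g i) J) I = finsum G (\<lambda>j. finsum G (\<lambda>i. g i j) I) J"
  using assms
proof (induction I rule: finite_induct)
  case (insert i I)
  have "finsum G (\<lambda>i. finsum G (g i) J) (insert i I) =
      finsum G (g i) J \<oplus> finsum G (\<lambda>j. finsum G (\<lambda>i. g i j) I) J"
    using insert by (subst finsum_insert) (auto intro!: finsum_closed)
  also have "\<dots> = finsum G (\<lambda>j. g i j \<oplus> finsum G (\<lambda>i. g i j) I) J"
    using insert by (subst finsum_addf) (auto intro!: finsum_closed)
  also have "\<dots> = finsum G (\<lambda>j. finsum G (\<lambda>i. g i j) (insert i I)) J"
    using insert by (intro finsum_cong') (auto simp: Pi_def intro!: finsum_closed)
  finally show ?case .
qed (simp add: finsum_zero)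

text \<open>Serves to multiply two expansions whose first tensor legs come from the same row of
  orthogonal projections: distributing both sums leaves only the diagonal.\<close>

lemma (in ring) finsum_mult_diagonal:
  assumes "finite I" "x \<in> I \<rightarrow> carrier R" "y \<in> I \<rightarrow> carrier R"
    and orth: "\<And>i j. i \<in> I \<Longrightarrow> j \<in> I \<Longrightarrow> i \<noteq> j \<Longrightarrow> x i \<otimes> y j = \<zero>"
  shows "finsum R x I \<otimes> finsum R y I = finsum R (\<lambda>i. x i \<otimes> y i) I"
proof -
  have "finsum R x I \<otimes> finsum R y I = finsum R (\<lambda>i. x i \<otimes> finsum R y I) I"
    using assms by (intro finsum_ldistr) (auto intro!: finsum_closed)
  also have "\<dots> = finsum R (\<lambda>i. x i \<otimes> y i) I"
  proof (rule finsum_cong')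
    fix i assume i: "i \<in> I"
    have "x i \<otimes> finsum R y I = finsum R (\<lambda>j. x i \<otimes> y j) I"
      using assms i by (intro finsum_rdistr) auto
    also have "\<dots> = finsum R (\<lambda>j. if i = j then x i \<otimes> y j else \<zero>) I"
      using assms i orth by (intro finsum_cong') (auto simp: Pi_def)
    also have "\<dots> = x i \<otimes> y i"
      using assms i by (intro finsum_singleton) (auto simp: Pi_def)
    finally show "x i \<otimes> finsum R y I = x i \<otimes> y i" .
  qed (use assms in auto)
  finally show ?thesis .
qed

text \<open>Only additivity is assumed, so that this covers the slices of a tensor product with one
  leg held fixed, which need not be ring homomorphisms.\<close>

lemma
  assumes R: "abelian_group R" and S: "abelian_group S"
    and closed: "\<And>x. x \<in> carrier R \<Longrightarrow> h x \<in> carrier S"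
    and add: "\<And>x y. x \<in> carrier R \<Longrightarrow> y \<in> carrier R \<Longrightarrow> h (x \<oplus>\<^bsub>R\<^esub> y) = h x \<oplus>\<^bsub>S\<^esub> h y"
  shows additive_zero: "h \<zero>\<^bsub>R\<^esub> = \<zero>\<^bsub>S\<^esub>"
    and additive_finsum: "finite I \<Longrightarrow> g \<in> I \<rightarrow> carrier R \<Longrightarrow>
      h (finsum R g I) = finsum S (\<lambda>i. h (g i)) I"
proof -
  interpret R: abelian_group R by (rule R)
  interpret S: abelian_group S by (rule S)
  have "h \<zero>\<^bsub>R\<^esub> \<oplus>\<^bsub>S\<^esub> h \<zero>\<^bsub>R\<^esub> = h \<zero>\<^bsub>R\<^esub>"
    using add[of "\<zero>\<^bsub>R\<^esub>" "\<zero>\<^bsub>R\<^esub>"] by simp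
  then show zero: "h \<zero>\<^bsub>R\<^esub> = \<zero>\<^bsub>S\<^esub>"
    using closed[of "\<zero>\<^bsub>R\<^esub>"] by (metis S.add.l_cancel_one R.zero_closed)
  show "h (finsum R g I) = finsum S (\<lambda>i. h (g i)) I"
    if "finite I" "g \<in> I \<rightarrow> carrier R"
    using that
  proof (induction I rule: finite_induct)
    case (insert i I)
    then show ?case
      using closed by (simp add: add Pi_def R.finsum_insert S.finsum_insert R.finsum_closed)
  qed (simp add: zero)
qed

text \<open>For three summands orthogonality is purely algebraic; for more summands it would need
  positivity in \<open>C\<^sup>*\<close>-algebras.\<close>

lemma (in ring) idempotents_orthogonal:
  assumes no_2_torsion: "\<And>x. x \<in> carrier R \<Longrightarrow> x \<oplus> x = \<zero> \<Longrightarrow> x = \<zero>"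
    and carr: "p \<in> carrier R" "q \<in> carrier R" "r \<in> carrier R"
    and idem: "p \<otimes> p = p" "q \<otimes> q = q" "r \<otimes> r = r"
    and sum: "p \<oplus> (q \<oplus> r) = \<one>"
  shows "p \<otimes> q = \<zero>"
proof -
  have "p \<otimes> (p \<oplus> (q \<oplus> r)) = p" using sum carr by simp
  then have "p \<oplus> (p \<otimes> q \<oplus> p \<otimes> r) = p" using carr by (simp add: r_distr idem)
  then have 1: "p \<otimes> q \<oplus> p \<otimes> r = \<zero>" using carr by simp
  have "(p \<oplus> (q \<oplus> r)) \<otimes> r = r" using sum carr by simp
  then have "(p \<otimes> r \<oplus> q \<otimes> r) \<oplus> r = r" using carr by (simp add: l_distr idem a_assoc)
  then have 2: "p \<otimes> r \<oplus> q \<otimes> r = \<zero>" using carr by simp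
  have "q \<otimes> (p \<oplus> (q \<oplus> r)) = q" using sum carr by simp
  then have "q \<oplus> (q \<otimes> p \<oplus> q \<otimes> r) = q"
    using carr by (simp add: r_distr idem a_lcomm)
  then have 3: "q \<otimes> p \<oplus> q \<otimes> r = \<zero>" using carr by simp
  \<comment> \<open>Both sides are the negative of \<open>p \<otimes> r\<close>. This eliminates
    \<open>r\<close> from the third relation and shows that \<open>p\<close> and \<open>q\<close>
    anticommute.\<close>
  have "p \<otimes> q = q \<otimes> r"
    using 1 2 carr by (metis a_comm m_closed minus_equality)
  with 3 have anti: "q \<otimes> p \<oplus> p \<otimes> q = \<zero>" by simp
  \<comment> \<open>Multiplying the anticommutation relation by \<open>p\<close> on either side
    shows that \<open>p \<otimes> q\<close> and \<open>q \<otimes> p\<close> are both the negative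
    of \<open>p \<otimes> q \<otimes> p\<close>. So \<open>p\<close> and \<open>q\<close> also
    commute, and twice their product is zero.\<close>
  have "p \<otimes> (q \<otimes> p \<oplus> p \<otimes> q) = \<zero>" "(q \<otimes> p \<oplus> p \<otimes> q) \<otimes> p = \<zero>"
    using anti carr by simp_all
  then have "p \<otimes> q \<otimes> p \<oplus> p \<otimes> q = \<zero>" "q \<otimes> p \<oplus> p \<otimes> q \<otimes> p = \<zero>"
    using carr by (simp_all add: l_distr r_distr m_assoc idem flip: m_assoc[of p p q])
  then have "p \<otimes> q = q \<otimes> p"
    using carr by (metis a_comm m_closed minus_equality)
  then show ?thesis using anti no_2_torsion[of "p \<otimes> q"] carr by simp
qed

text \<open>The complex scalar 1/2 is available, so doubling can be undone.\<close>

lemma star_algebra_no_2_torsion: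
  assumes "star_algebra A" "x \<in> carrier A" "x \<oplus>\<^bsub>A\<^esub> x = \<zero>\<^bsub>A\<^esub>"
  shows "x = \<zero>\<^bsub>A\<^esub>"
proof -
  interpret module "ring_of_type_algebra :: complex ring" A
    using assms(1) by (simp add: star_algebra_def)
  have "(1/2 + 1/2 :: complex) \<odot>\<^bsub>A\<^esub> x = (1/2) \<odot>\<^bsub>A\<^esub> (x \<oplus>\<^bsub>A\<^esub> x)"
    using smult_l_distr[of "1/2" "1/2" x] smult_r_distr[of "1/2" x x] assms(2)
    by (simp add: ring_of_type_algebra_def)
  then show ?thesis
    using smult_one[of x] assms(2,3) smult_r_null[of "1/2"]
    by (simp add: ring_of_type_algebra_def)
qed

lemma magic_unitary_3_orthogonal:
  assumes A: "star_algebra A" and u: "magic_unitary 3 A u"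
    and ijk: "i \<in> {1..3}" "j \<in> {1..3}" "k \<in> {1..3}" "j \<noteq> k"
  shows "u i j \<otimes>\<^bsub>A\<^esub> u i k = \<zero>\<^bsub>A\<^esub>"
proof -
  interpret ring A using A by (simp add: star_algebra_def)
  obtain l where l: "{1..3} = {j, k, l}" "l \<noteq> j" "l \<noteq> k"
  proof
    \<comment> \<open>The third index is found from 1 + 2 + 3 = 6.\<close>
    show "{1..3} = {j, k, 6 - j - k}" "6 - j - k \<noteq> j" "6 - j - k \<noteq> k"
    proof -
      have "j = 1 \<or> j = 2 \<or> j = 3" "k = 1 \<or> k = 2 \<or> k = 3" using ijk by auto
      then show "{1..3} = {j, k, 6 - j - k}" "6 - j - k \<noteq> j" "6 - j - k \<noteq> k"
        using ijk(4) by auto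
    qed
  qed
  have carr: "u i m \<in> carrier A" "u i m \<otimes>\<^bsub>A\<^esub> u i m = u i m" if "m \<in> {j, k, l}" for m
    using u ijk(1) l that by (auto simp: magic_unitary_def)
  have "finsum A (u i) {j, k, l} = \<one>\<^bsub>A\<^esub>"
    using u ijk(1) l by (auto simp: magic_unitary_def)
  then have "u i j \<oplus>\<^bsub>A\<^esub> (u i k \<oplus>\<^bsub>A\<^esub> u i l) = \<one>\<^bsub>A\<^esub>"
    using l ijk carr by (simp add: finsum_insert)
  then show ?thesis
    using carr by (intro idempotents_orthogonal[where r = "u i l"])
      (assumption | rule star_algebra_no_2_torsion[OF A] | simp)+
qed

section \<open>A noncommutative magic unitary\<close>

text \<open>The four entries sit at the arguments 0 to 3. Every later argument repeats the last
  entry, which does not affect injectivity.\<close>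

definition matrix_code :: "complex^2^2 \<Rightarrow> nat \<Rightarrow> complex" where
  "matrix_code M k = (if k = 0 then M $ 1 $ 1 else if k = 1 then M $ 1 $ 2
     else if k = 2 then M $ 2 $ 1 else M $ 2 $ 2)"

lemma inj_matrix_code: "inj matrix_code"
proof (rule injI)
  fix M N assume "matrix_code M = matrix_code N"
  then have "matrix_code M k = matrix_code N k" for k by simp
  from this[of 0] this[of 1] this[of 2] this[of 3] show "M = N"
    by (simp add: matrix_code_def vec_eq_iff forall_2)
qed

text \<open>The diagonal entries of \<open>proj_p\<close> are different because otherwise it would commute with
  its own off-diagonal part, which is the image of the fixed element.\<close>

definition proj_p :: "complex^2^2" where
  "proj_p = vector [vector [1/5, 2/5], vector [2/5, 4/5]]"

definition proj_q :: "complex^2^2" where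
  "proj_q = vector [vector [1, 0], vector [0, 0]]"

definition magic_block :: "nat \<Rightarrow> nat \<Rightarrow> complex^2^2" where
  "magic_block i j =
     (if i \<in> {1,2} \<and> j \<in> {1,2} then if i = j then proj_p else mat 1 - proj_p
      else if i \<in> {3,4} \<and> j \<in> {3,4} then if i = j then proj_q else mat 1 - proj_q
      else 0)"

text \<open>\<open>proj_p\<close> and \<open>proj_q\<close> are the orthogonal projections onto the
  lines spanned by (1,2) and (1,0); their entries are rational, so everything is settled by direct
  computation.\<close>

lemma proj_idempotent:
  "proj_p ** proj_p = proj_p" "(mat 1 - proj_p) ** (mat 1 - proj_p) = mat 1 - proj_p"
  "proj_q ** proj_q = proj_q" "(mat 1 - proj_q) ** (mat 1 - proj_q) = mat 1 - proj_q"
  by (simp_all add: proj_p_def proj_q_def matrix_matrix_mult_def mat_def vec_eq_iff forall_2 sum_2)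

lemma proj_selfadjoint:
  "conj_transpose proj_p = proj_p" "conj_transpose (mat 1 - proj_p) = mat 1 - proj_p"
  "conj_transpose proj_q = proj_q" "conj_transpose (mat 1 - proj_q) = mat 1 - proj_q"
  "conj_transpose 0 = (0 :: complex^2^2)"
  by (simp_all add: proj_p_def proj_q_def conj_transpose_def mat_def vec_eq_iff forall_2)

lemma atLeastAtMost_1_4: "{1..4} = {1, 2, 3, 4 :: nat}"
  by auto

lemma atLeastAtMost_2_4: "{2..4} = {2, 3, 4 :: nat}"
  by auto

lemma magic_unitary_magic_block:
  assumes e: "inj e"
  shows "magic_unitary 4 (matrix_cstar e) (\<lambda>i j. e (magic_block i j))"
proof -
  interpret ring "matrix_cstar e"
    using star_algebra_matrix_cstar[OF e] by (simp add: star_algebra_def)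
  note s = matrix_cstar_simps[OF e]
  show ?thesis
    unfolding magic_unitary_def atLeastAtMost_1_4
    by (auto simp: s magic_block_def finsum_insert proj_idempotent proj_selfadjoint)
qed

text \<open>Here \<open>y\<close> is the off-diagonal part of \<open>proj_p\<close>. The (1,2)
  entries of the two products are 2/5 times the diagonal entries 4/5 and 1/5 of
  \<open>proj_p\<close>, hence different.\<close>

lemma magic_block_noncommuting:
  fixes y :: "complex^2^2"
  defines "y \<equiv> magic_block 3 3 ** (magic_block 1 1 ** magic_block 3 4) +
    magic_block 4 3 ** (magic_block 1 1 ** magic_block 4 4)"
  shows "y ** magic_block 1 1 \<noteq> magic_block 1 1 ** y"
proof -
  have y: "y = vector [vector [0, 2/5], vector [2/5, 0]]"
    unfolding y_def by (simp add: magic_block_def proj_p_def proj_q_def matrix_matrix_mult_def mat_def vec_eq_iff forall_2 sum_2)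
  show ?thesis
    unfolding y by (simp add: magic_block_def proj_p_def matrix_matrix_mult_def vec_eq_iff forall_2 sum_2)
qed

section \<open>Noncommutativity of the coset algebra\<close>

lemma C_X_mult_comm: "x \<otimes>\<^bsub>C_X n\<^esub> y = y \<otimes>\<^bsub>C_X n\<^esub> x"
  by (simp add: C_X_def mult.commute)

text \<open>A commutation relation in \<open>A\<close> survives every homomorphism, so one
  representation violating it suffices.\<close>

lemma A_aut_4_noncommuting:
  assumes A: "A_aut 4 A a"
  defines "y \<equiv> finsum A (\<lambda>u. a u 3 \<otimes>\<^bsub>A\<^esub> (a 1 1 \<otimes>\<^bsub>A\<^esub> a u 4)) {2..4}"
  shows "y \<otimes>\<^bsub>A\<^esub> a 1 1 \<noteq> a 1 1 \<otimes>\<^bsub>A\<^esub> y"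
proof
  assume comm: "y \<otimes>\<^bsub>A\<^esub> a 1 1 = a 1 1 \<otimes>\<^bsub>A\<^esub> y"
  let ?B = "matrix_cstar matrix_code"
  note e = inj_matrix_code
  note s = matrix_cstar_simps[OF e]
  obtain f where f: "f \<in> star_hom A ?B"
    and fa: "\<And>i j. i \<in> {1..4} \<Longrightarrow> j \<in> {1..4} \<Longrightarrow> f (a i j) = matrix_code (magic_block i j)"
  proof -
    have "\<forall>(B :: (nat \<Rightarrow> complex) cstar) b. cstar_algebra B \<and> magic_unitary 4 B b \<longrightarrow>
        (\<exists>f\<in>star_hom A B. \<forall>i\<in>{1..4}. \<forall>j\<in>{1..4}. f (a i j) = b i j)"
      using A by (simp add: A_aut_def)
    from this[rule_format, OF conjI, OF cstar_algebra_matrix_cstar[OF e] magic_unitary_magic_block[OF e]]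
    show thesis using that by blast
  qed
  interpret A: ring A
    using A by (simp add: A_aut_def cstar_algebra_def star_algebra_def)
  have hom: "f \<in> ring_hom A ?B" using f by (simp add: star_hom_def)
  have a: "a i j \<in> carrier A" if "i \<in> {1..4}" "j \<in> {1..4}" for i j
    using A that by (auto simp: A_aut_def magic_unitary_def)
  have y: "y = a 2 3 \<otimes>\<^bsub>A\<^esub> (a 1 1 \<otimes>\<^bsub>A\<^esub> a 2 4) \<oplus>\<^bsub>A\<^esub>
      (a 3 3 \<otimes>\<^bsub>A\<^esub> (a 1 1 \<otimes>\<^bsub>A\<^esub> a 3 4) \<oplus>\<^bsub>A\<^esub> a 4 3 \<otimes>\<^bsub>A\<^esub> (a 1 1 \<otimes>\<^bsub>A\<^esub> a 4 4))"
    unfolding y_def atLeastAtMost_2_4 by (simp add: A.finsum_insert a)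
  have yc: "y \<in> carrier A" unfolding y by (simp add: a)
  \<comment> \<open>The summand for \<open>u = 2\<close> vanishes, since the entries (2,3) and (2,4)
    lie outside the diagonal blocks.\<close>
  have "f y = matrix_code (magic_block 3 3 ** (magic_block 1 1 ** magic_block 3 4) +
      magic_block 4 3 ** (magic_block 1 1 ** magic_block 4 4))"
    unfolding y
    by (simp add: ring_hom_add[OF hom] ring_hom_mult[OF hom] a fa s)
       (simp add: magic_block_def)
  moreover have "f y \<otimes>\<^bsub>?B\<^esub> f (a 1 1) = f (a 1 1) \<otimes>\<^bsub>?B\<^esub> f y"
    using arg_cong[OF comm, of f] by (simp add: ring_hom_mult[OF hom] yc a)
  ultimately show False
    using magic_block_noncommuting by (simp add: fa s inj_eq[OF e])
qed

theorem proposition6p2: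
  fixes A :: "'a cstar" and a :: "nat \<Rightarrow> nat \<Rightarrow> 'a"
    and T :: "'s cstar" and t :: "'a \<Rightarrow> 'a \<Rightarrow> 's" and \<Phi> :: "'a \<Rightarrow> 's"
    and C :: "'c cstar" and c :: "nat \<Rightarrow> nat \<Rightarrow> 'c" and \<theta> :: "'a \<Rightarrow> 'c"
    and T' :: "'t cstar" and t' :: "'c \<Rightarrow> 'a \<Rightarrow> 't" and \<Theta> :: "'s \<Rightarrow> 't"
    and TX :: "'u cstar" and tX :: "(nat \<Rightarrow> complex) \<Rightarrow> 'a \<Rightarrow> 'u"
    and \<alpha> :: "(nat \<Rightarrow> complex) \<Rightarrow> 'u"
  assumes G: "quantum_aut_group 4 A a T t \<Phi>"
    and H: "A_aut 3 C c"
    and \<theta>_hom: "\<theta> \<in> star_hom A C"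
    and \<theta>_fix: "\<theta> (a 1 1) = \<one>\<^bsub>C\<^esub>"
      "\<And>j. j \<in> {2..4} \<Longrightarrow> \<theta> (a 1 j) = \<zero>\<^bsub>C\<^esub> \<and> \<theta> (a j 1) = \<zero>\<^bsub>C\<^esub>"
    and \<theta>_gen: "\<And>i j. i \<in> {2..4} \<Longrightarrow> j \<in> {2..4} \<Longrightarrow> \<theta> (a i j) = c (i - 1) (j - 1)"
    and HG: "min_tensor C A T' t'"
    and \<Theta>: "tensor_hom A A T t T' t' \<theta> id \<Theta>"
    and XG: "min_tensor (C_X 4) A TX tX"
    and \<alpha>_hom: "\<alpha> \<in> star_hom (C_X 4) TX"
    and \<alpha>_gen: "\<And>j. j \<in> {1..4} \<Longrightarrow>
      \<alpha> (char_fun 4 j) = finsum TX (\<lambda>i. tX (char_fun 4 i) (a i j)) {1..4}"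
  shows "\<not> G_algebra_isomorphic A
      (restricted_action (coset_algebra A \<Phi> C t' \<Theta>) A T t \<Phi>)
      \<lparr>act_alg = C_X 4, act_tensor = TX, act_elem = tX, act_map = \<alpha>\<rparr>"
proof
  assume iso: "G_algebra_isomorphic A
      (restricted_action (coset_algebra A \<Phi> C t' \<Theta>) A T t \<Phi>)
      \<lparr>act_alg = C_X 4, act_tensor = TX, act_elem = tX, act_map = \<alpha>\<rparr>"
  define D where "D = {x \<in> carrier A. \<Theta> (\<Phi> x) = t' \<one>\<^bsub>C\<^esub> x}"
  obtain f where f: "f \<in> star_iso (coset_algebra A \<Phi> C t' \<Theta>) (C_X 4)"
    using iso by (auto simp: G_algebra_isomorphic_def restricted_action_def)
  have f_mult: "f (x \<otimes>\<^bsub>A\<^esub> y) = f x \<otimes>\<^bsub>C_X 4\<^esub> f y" if "x \<in> D" "y \<in> D" for x y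
    using f that by (simp add: star_iso_def star_hom_def ring_hom_def coset_algebra_def D_def)
  have f_inj: "inj_on f D"
    using f by (simp add: star_iso_def coset_algebra_def D_def bij_betw_def)

  \<comment> \<open>Homomorphism and tensor product rules extracted from the hypotheses\<close>
  have Aaut: "A_aut 4 A a" and AT: "min_tensor A A T t" and \<Phi>_star: "\<Phi> \<in> star_hom A T"
    and \<Phi>_gen: "\<And>i j. i \<in> {1..4} \<Longrightarrow> j \<in> {1..4} \<Longrightarrow>
      \<Phi> (a i j) = finsum T (\<lambda>k. t (a i k) (a k j)) {1..4}"
    using G by (simp_all add: quantum_aut_group_def)
  have star: "star_algebra A" "star_algebra C" "star_algebra T" "star_algebra T'"
    using AT HG by (simp_all add: min_tensor_def cstar_algebra_def)
  interpret A: ring A using star by (simp add: star_algebra_def)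
  interpret C: ring C using star by (simp add: star_algebra_def)
  interpret T: ring T using star by (simp add: star_algebra_def)
  interpret T': ring T' using star by (simp add: star_algebra_def)
  have \<theta>: "\<theta> \<in> ring_hom A C" and \<Phi>: "\<Phi> \<in> ring_hom A T" and \<Theta>_hom: "\<Theta> \<in> ring_hom T T'"
    and \<Theta>_t: "\<And>x y. x \<in> carrier A \<Longrightarrow> y \<in> carrier A \<Longrightarrow> \<Theta> (t x y) = t' (\<theta> x) y"
    using \<theta>_hom \<Phi>_star \<Theta> by (simp_all add: star_hom_def tensor_hom_def)
  have a: "a i j \<in> carrier A" if "i \<in> {1..4}" "j \<in> {1..4}" for i j
    using Aaut that by (auto simp: A_aut_def magic_unitary_def)
  have t: "t x y \<in> carrier T" if "x \<in> carrier A" "y \<in> carrier A" for x y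
    using AT that by (simp add: min_tensor_def)
  have t': "t' x y \<in> carrier T'" if "x \<in> carrier C" "y \<in> carrier A" for x y
    using HG that by (simp add: min_tensor_def)
  have t'_add1: "t' (x \<oplus>\<^bsub>C\<^esub> x') y = t' x y \<oplus>\<^bsub>T'\<^esub> t' x' y"
    if "x \<in> carrier C" "x' \<in> carrier C" "y \<in> carrier A" for x x' y
    using HG that by (simp add: min_tensor_def)
  have t'_add2: "t' x (y \<oplus>\<^bsub>A\<^esub> y') = t' x y \<oplus>\<^bsub>T'\<^esub> t' x y'"
    if "x \<in> carrier C" "y \<in> carrier A" "y' \<in> carrier A" for x y y'
    using HG that by (simp add: min_tensor_def)
  have t'_mult: "t' x y \<otimes>\<^bsub>T'\<^esub> t' x' y' = t' (x \<otimes>\<^bsub>C\<^esub> x') (y \<otimes>\<^bsub>A\<^esub> y')"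
    if "x \<in> carrier C" "x' \<in> carrier C" "y \<in> carrier A" "y' \<in> carrier A" for x x' y y'
    using HG that by (simp add: min_tensor_def)
  have t'_zero: "t' \<zero>\<^bsub>C\<^esub> y = \<zero>\<^bsub>T'\<^esub>" if "y \<in> carrier A" for y
    using that by (intro additive_zero[of C T' "\<lambda>x. t' x y"] C.abelian_group_axioms
        T'.abelian_group_axioms t' t'_add1)
  have t'_sum1: "t' (finsum C g I) y = finsum T' (\<lambda>i. t' (g i) y) I"
    if "finite I" "g \<in> I \<rightarrow> carrier C" "y \<in> carrier A" for g y and I :: "nat set"
    using that by (intro additive_finsum[of C T' "\<lambda>x. t' x y"] C.abelian_group_axioms
        T'.abelian_group_axioms t' t'_add1)
  have t'_sum2: "t' x (finsum A g I) = finsum T' (\<lambda>i. t' x (g i)) I"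
    if "finite I" "g \<in> I \<rightarrow> carrier A" "x \<in> carrier C" for g x and I :: "nat set"
    using that by (intro additive_finsum[of A T' "t' x"] A.abelian_group_axioms
        T'.abelian_group_axioms t' t'_add2)

  \<comment> \<open>The homomorphism \<Psi> = (\<theta> \<otimes> 1)\<Phi> on the generators\<close>
  define \<Psi> where "\<Psi> x = \<Theta> (\<Phi> x)" for x
  have \<Psi>_closed: "\<Psi> x \<in> carrier T'" if "x \<in> carrier A" for x
    using that by (simp add: \<Psi>_def ring_hom_closed[OF \<Phi>] ring_hom_closed[OF \<Theta>_hom])
  have \<Psi>_add: "\<Psi> (x \<oplus>\<^bsub>A\<^esub> y) = \<Psi> x \<oplus>\<^bsub>T'\<^esub> \<Psi> y" if "x \<in> carrier A" "y \<in> carrier A" for x y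
    using that by (simp add: \<Psi>_def ring_hom_closed[OF \<Phi>] ring_hom_add[OF \<Phi>] ring_hom_add[OF \<Theta>_hom])
  have \<Psi>_mult: "\<Psi> (x \<otimes>\<^bsub>A\<^esub> y) = \<Psi> x \<otimes>\<^bsub>T'\<^esub> \<Psi> y" if "x \<in> carrier A" "y \<in> carrier A" for x y
    using that by (simp add: \<Psi>_def ring_hom_closed[OF \<Phi>] ring_hom_mult[OF \<Phi>] ring_hom_mult[OF \<Theta>_hom])
  have \<theta>_closed: "\<theta> x \<in> carrier C" if "x \<in> carrier A" for x
    using that by (rule ring_hom_closed[OF \<theta>])
  \<comment> \<open>Index 1 is separated because \<theta> sends the first row and column to 0 or 1,
    while the indices 2 to 4 carry the generators of \<open>C\<close>.\<close>
  have split: "{1..4} = insert 1 {2..4::nat}" by auto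
  have \<Psi>_a: "\<Psi> (a i j) = t' (\<theta> (a i 1)) (a 1 j) \<oplus>\<^bsub>T'\<^esub>
      finsum T' (\<lambda>k. t' (\<theta> (a i k)) (a k j)) {2..4}"
    if "i \<in> {1..4}" "j \<in> {1..4}" for i j
  proof -
    have "\<Psi> (a i j) = finsum T' (\<lambda>k. \<Theta> (t (a i k) (a k j))) {1..4}"
      unfolding \<Psi>_def \<Phi>_gen[OF that] using that
      by (intro additive_finsum[of T T' \<Theta>] T.abelian_group_axioms T'.abelian_group_axioms
          ring_hom_closed[OF \<Theta>_hom] ring_hom_add[OF \<Theta>_hom]) (auto intro!: t a)
    also have "\<dots> = finsum T' (\<lambda>k. t' (\<theta> (a i k)) (a k j)) {1..4}"
      using that by (intro T'.finsum_cong') (auto intro!: \<Theta>_t t' \<theta>_closed a)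
    also have "\<dots> = t' (\<theta> (a i 1)) (a 1 j) \<oplus>\<^bsub>T'\<^esub>
        finsum T' (\<lambda>k. t' (\<theta> (a i k)) (a k j)) {2..4}"
      unfolding split using that by (intro T'.finsum_insert) (auto intro!: t' \<theta>_closed a)
    finally show ?thesis .
  qed
  have \<Psi>_a11: "\<Psi> (a 1 1) = t' \<one>\<^bsub>C\<^esub> (a 1 1)"
  proof -
    have "finsum T' (\<lambda>k. t' (\<theta> (a 1 k)) (a k 1)) {2..4} = finsum T' (\<lambda>k. \<zero>\<^bsub>T'\<^esub>) {2..4::nat}"
    proof (rule T'.finsum_cong')
      fix k :: nat assume k: "k \<in> {2..4}"
      then show "t' (\<theta> (a 1 k)) (a k 1) = \<zero>\<^bsub>T'\<^esub>"
        using \<theta>_fix(2)[OF k] t'_zero[OF a[of k 1]] by simp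
    qed simp_all
    then show ?thesis using \<theta>_fix(1) by (simp add: \<Psi>_a t' a)
  qed
  \<comment> \<open>The term \<open>k = 1\<close> drops out, as \<theta> kills \<open>a i 1\<close>
    for \<open>i\<close> at least 2.\<close>
  have \<Psi>_row: "\<Psi> (a i j) = finsum T' (\<lambda>k. t' (\<theta> (a i k)) (a k j)) {2..4}"
    if "i \<in> {2..4}" "j \<in> {1..4}" for i j
  proof -
    have "finsum T' (\<lambda>k. t' (\<theta> (a i k)) (a k j)) {2..4} \<in> carrier T'"
      using that by (intro T'.finsum_closed) (auto intro!: t' \<theta>_closed a)
    then show ?thesis
      using that \<theta>_fix(2)[OF that(1)] by (simp add: \<Psi>_a t'_zero a)
  qed

  \<comment> \<open>Projections, orthogonal rows and column sums in \<open>C\<close>\<close>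
  have c: "magic_unitary 3 C c" using H by (simp add: A_aut_def)
  have \<theta>_idem: "\<theta> (a p u) \<otimes>\<^bsub>C\<^esub> \<theta> (a p u) = \<theta> (a p u)" if "p \<in> {2..4}" "u \<in> {2..4}" for p u
  proof -
    have "p - 1 \<in> {1..3}" "u - 1 \<in> {1..3}" using that by auto
    then show ?thesis using c by (simp add: \<theta>_gen[OF that] magic_unitary_def)
  qed
  \<comment> \<open>Orthogonality is obtained after applying \<theta>, where a row consists of only
    three projections and the algebraic argument applies.\<close>
  have \<theta>_orth: "\<theta> (a p u) \<otimes>\<^bsub>C\<^esub> \<theta> (a p w) = \<zero>\<^bsub>C\<^esub>"
    if "p \<in> {2..4}" "u \<in> {2..4}" "w \<in> {2..4}" "u \<noteq> w" for p u w
    using that unfolding \<theta>_gen[OF that(1,2)] \<theta>_gen[OF that(1,3)]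
    by (intro magic_unitary_3_orthogonal[OF star(2) c]) auto
  have \<theta>_col: "finsum C (\<lambda>p. \<theta> (a p u)) {2..4} = \<one>\<^bsub>C\<^esub>" if "u \<in> {2..4}" for u
  proof -
    have u: "u - 1 \<in> {1..3}" using that by auto
    \<comment> \<open>\<open>Suc\<close> matches the indices 1 to 3 of \<open>c\<close> with the
      indices 2 to 4 of \<open>a\<close>.\<close>
    have "finsum C (\<lambda>p. \<theta> (a p u)) (Suc ` {1..3}) = finsum C (\<lambda>p. \<theta> (a (Suc p) u)) {1..3}"
      using that by (intro C.finsum_reindex) (auto intro!: \<theta>_closed a)
    also have "\<dots> = finsum C (\<lambda>p. c p (u - 1)) {1..3}"
    proof (rule C.finsum_cong')
      show "(\<lambda>p. c p (u - 1)) \<in> {1..3} \<rightarrow> carrier C"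
        using u c by (simp add: magic_unitary_def)
      show "\<theta> (a (Suc p) u) = c p (u - 1)" if "p \<in> {1..3}" for p
        using \<theta>_gen[of "Suc p" u] that \<open>u \<in> {2..4}\<close> by simp
    qed simp
    also have "\<dots> = \<one>\<^bsub>C\<^esub>"
      using u c by (simp add: magic_unitary_def)
    also have "Suc ` {1..3} = {2..4}" by (simp add: image_Suc_atLeastAtMost)
    finally show ?thesis .
  qed

  \<comment> \<open>A second fixed element, built around \<open>a 1 1\<close>\<close>
  define y where "y u = a u 3 \<otimes>\<^bsub>A\<^esub> (a 1 1 \<otimes>\<^bsub>A\<^esub> a u 4)" for u
  define x where "x = finsum A y {2..4}"
  have y: "y u \<in> carrier A" if "u \<in> {1..4}" for u
    using that by (simp add: y_def a)
  have x: "x \<in> carrier A"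
    unfolding x_def by (intro A.finsum_closed) (auto intro!: y)
  have \<Psi>_y: "\<Psi> (y p) = finsum T' (\<lambda>u. t' (\<theta> (a p u)) (y u)) {2..4}" if p: "p \<in> {2..4}" for p
  proof -
    \<comment> \<open>Because \<Psi> maps \<open>a 1 1\<close> to a tensor with first leg 1,
      inserting it between two generators leaves their first legs adjacent.\<close>
    have "t' \<one>\<^bsub>C\<^esub> (a 1 1) \<otimes>\<^bsub>T'\<^esub> \<Psi> (a p 4) =
        finsum T' (\<lambda>w. t' \<one>\<^bsub>C\<^esub> (a 1 1) \<otimes>\<^bsub>T'\<^esub> t' (\<theta> (a p w)) (a w 4)) {2..4}"
      using p by (simp add: \<Psi>_row, intro T'.finsum_rdistr) (auto intro!: t' \<theta>_closed a)
    also have "\<dots> = finsum T' (\<lambda>w. t' (\<theta> (a p w)) (a 1 1 \<otimes>\<^bsub>A\<^esub> a w 4)) {2..4}"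
      using p by (intro T'.finsum_cong') (auto simp: t'_mult t' \<theta>_closed a)
    finally have "\<Psi> (y p) = finsum T' (\<lambda>u. t' (\<theta> (a p u)) (a u 3)) {2..4} \<otimes>\<^bsub>T'\<^esub>
        finsum T' (\<lambda>w. t' (\<theta> (a p w)) (a 1 1 \<otimes>\<^bsub>A\<^esub> a w 4)) {2..4}"
      using p \<Psi>_a11 by (simp add: y_def \<Psi>_mult a flip: \<Psi>_row)
    \<comment> \<open>Distinct summation indices give orthogonal first legs, so the double sum
      collapses to its diagonal; idempotence then merges the two equal legs.\<close>
    also have "\<dots> = finsum T' (\<lambda>u. t' (\<theta> (a p u)) (a u 3) \<otimes>\<^bsub>T'\<^esub>
        t' (\<theta> (a p u)) (a 1 1 \<otimes>\<^bsub>A\<^esub> a u 4)) {2..4}"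
      using p by (intro T'.finsum_mult_diagonal)
        (auto simp: t'_mult \<theta>_orth t'_zero t' \<theta>_closed a)
    also have "\<dots> = finsum T' (\<lambda>u. t' (\<theta> (a p u)) (y u)) {2..4}"
      using p by (intro T'.finsum_cong') (auto simp: t'_mult \<theta>_idem y_def t' \<theta>_closed a)
    finally show ?thesis .
  qed
  have "\<Psi> x = finsum T' (\<lambda>p. \<Psi> (y p)) {2..4}"
    unfolding x_def
    by (intro additive_finsum[of A T' \<Psi>] A.abelian_group_axioms T'.abelian_group_axioms
        \<Psi>_closed \<Psi>_add) (auto intro!: y)
  also have "\<dots> = finsum T' (\<lambda>p. finsum T' (\<lambda>u. t' (\<theta> (a p u)) (y u)) {2..4}) {2..4}"
    by (intro T'.finsum_cong') (auto simp: \<Psi>_y intro!: T'.finsum_closed t' \<theta>_closed a y)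
  \<comment> \<open>After the exchange the inner sum runs down a column, where the first legs add up
    to 1 and the second leg \<open>y u\<close> is constant.\<close>
  also have "\<dots> = finsum T' (\<lambda>u. finsum T' (\<lambda>p. t' (\<theta> (a p u)) (y u)) {2..4}) {2..4}"
    by (intro T'.finsum_swap) (auto intro!: t' \<theta>_closed a y)
  also have "\<dots> = finsum T' (\<lambda>u. t' \<one>\<^bsub>C\<^esub> (y u)) {2..4}"
  proof (rule T'.finsum_cong')
    fix u :: nat assume u: "u \<in> {2..4}"
    have "finsum T' (\<lambda>p. t' (\<theta> (a p u)) (y u)) {2..4} =
        t' (finsum C (\<lambda>p. \<theta> (a p u)) {2..4}) (y u)"
      using u by (intro t'_sum1[symmetric]) (auto intro!: \<theta>_closed a y)
    then show "finsum T' (\<lambda>p. t' (\<theta> (a p u)) (y u)) {2..4} = t' \<one>\<^bsub>C\<^esub> (y u)"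
      by (simp add: \<theta>_col[OF u])
  qed (auto intro!: t' y)
  also have "\<dots> = t' \<one>\<^bsub>C\<^esub> x"
    unfolding x_def by (intro t'_sum2[symmetric]) (auto intro!: y)
  finally have "x \<in> D" using x by (simp add: D_def \<Psi>_def)

  \<comment> \<open>Contradiction with the commutativity of functions on four points\<close>
  have a11: "a 1 1 \<in> D" using \<Psi>_a11 by (simp add: D_def \<Psi>_def a)
  \<comment> \<open>Injectivity of \<open>f\<close> holds on \<open>D\<close>, so both products must
    lie in \<open>D\<close> before equality of their images can be pulled back.\<close>
  have D_mult: "v \<otimes>\<^bsub>A\<^esub> w \<in> D" if "v \<in> D" "w \<in> D" for v w
    using that \<Psi>_mult[of v w] by (simp add: D_def \<Psi>_def t'_mult)
  have "f (x \<otimes>\<^bsub>A\<^esub> a 1 1) = f (a 1 1 \<otimes>\<^bsub>A\<^esub> x)"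
    unfolding f_mult[OF \<open>x \<in> D\<close> a11] f_mult[OF a11 \<open>x \<in> D\<close>]
    by (rule C_X_mult_comm)
  then have "x \<otimes>\<^bsub>A\<^esub> a 1 1 = a 1 1 \<otimes>\<^bsub>A\<^esub> x"
    using f_inj D_mult \<open>x \<in> D\<close> a11 by (simp add: inj_on_eq_iff)
  then show False
    using A_aut_4_noncommuting[OF Aaut] by (simp add: x_def y_def[abs_def])
qed

end
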